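(* Let $t \in (-\frac12, 0)$, let $\mu$ be one-half of Lebesgue measure on the interval $[t,t+1]$, and let $\rho = \mu\times\delta_0 + \delta_0\times\mu$, a Borel probability measure on $\mathbb{R}^2$. Then $\rho$ is not spectral.
   Context: $\delta_0$ is the Dirac measure at $0\in\mathbb{R}$; thus $\int g\,d\rho = \frac12\int_t^{t+1} g(s,0)\,ds + \frac12\int_t^{t+1} g(0,s)\,ds$. For $\lambda\in\mathbb{R}^2$ write $e_\lambda(x)=e^{2\pi i\lambda\cdot x}$. A compactly supported Borel probability measure $\nu$ on $\mathbb{R}^2$ is spectral if there is a countable set $\Lambda\subset\mathbb{R}^2$ (called a spectrum of $\nu$) such that the family $(e_\lambda)_{\lambda\in\Lambda}$ is an orthogonal basis of $L^2(\nu)$ (i.e. $e_\lambda$, $e_{\lambda'}$ are orthogonal in $L^2(\nu)$ for distinct $\lambda,\lambda'\in\Lambda$, and the linear span is dense). *)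

theory Defs
  imports "HOL-Probability.Probability"
begin

text \<open>\<open>M\<close> and \<open>N\<close> are meant to live on the same \<open>\<sigma>\<close>-algebra.\<close>

definition add_measure :: "'a measure \<Rightarrow> 'a measure \<Rightarrow> 'a measure" where
  "add_measure M N = measure_of (space M) (sets M) (\<lambda>A. emeasure M A + emeasure N A)"

definition mu :: "real \<Rightarrow> real measure" where
  "mu t = scale_measure (1 / 2) (density lborel (indicator {t..t + 1}))"

abbreviation dirac0 :: "real measure" where
  "dirac0 \<equiv> return borel 0"

definition rho :: "real \<Rightarrow> (real \<times> real) measure" where
  "rho t = add_measure (mu t \<Otimes>\<^sub>M dirac0) (dirac0 \<Otimes>\<^sub>M mu t)"

definition exp_char :: "real \<times> real \<Rightarrow> real \<times> real \<Rightarrow> complex" where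
  "exp_char l x = exp (2 * pi * \<i> * of_real (l \<bullet> x))"

definition L2_fun :: "'a measure \<Rightarrow> ('a \<Rightarrow> complex) set" where
  "L2_fun M = {f \<in> borel_measurable M. integrable M (\<lambda>x. (norm (f x))\<^sup>2)}"

definition L2_inner :: "'a measure \<Rightarrow> ('a \<Rightarrow> complex) \<Rightarrow> ('a \<Rightarrow> complex) \<Rightarrow> complex" where
  "L2_inner M f g = (\<integral>x. f x * cnj (g x) \<partial>M)"

definition L2_norm :: "'a measure \<Rightarrow> ('a \<Rightarrow> complex) \<Rightarrow> real" where
  "L2_norm M f = sqrt (\<integral>x. (norm (f x))\<^sup>2 \<partial>M)"

text \<open>Density is density of the complex-linear span of the exponentials with respect to the
  \<open>L\<^sup>2\<close>-seminorm.\<close>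

definition is_spectrum :: "(real \<times> real) measure \<Rightarrow> (real \<times> real) set \<Rightarrow> bool" where
  "is_spectrum \<nu> \<Lambda> \<longleftrightarrow>
     countable \<Lambda> \<and>
     (\<forall>l\<in>\<Lambda>. \<forall>l'\<in>\<Lambda>. l \<noteq> l' \<longrightarrow> L2_inner \<nu> (exp_char l) (exp_char l') = 0) \<and>
     (\<forall>f\<in>L2_fun \<nu>. \<forall>\<epsilon>>0. \<exists>F c. finite F \<and> F \<subseteq> \<Lambda> \<and>
        L2_norm \<nu> (\<lambda>x. f x - (\<Sum>l\<in>F. c l * exp_char l x)) < \<epsilon>)"

text \<open>Intended for compactly supported Borel probability measures; \<open>rho t\<close> is shown to be
  one below. These conditions are not conjuncts of the definition, so that \<open>\<not> spectral \<nu>\<close>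
  always means that no spectrum exists.\<close>

definition spectral :: "(real \<times> real) measure \<Rightarrow> bool" where
  "spectral \<nu> \<longleftrightarrow> (\<exists>\<Lambda>. is_spectrum \<nu> \<Lambda>)"

lemma space_add_measure [simp]: "space (add_measure M N) = space M"
  and sets_add_measure [simp, measurable_cong]: "sets (add_measure M N) = sets M"
  by (simp_all add: add_measure_def)

lemma emeasure_add_measure:
  assumes "sets N = sets M" "A \<in> sets M"
  shows "emeasure (add_measure M N) A = emeasure M A + emeasure N A"
  unfolding add_measure_def
proof (rule emeasure_measure_of_sigma)
  show "sigma_algebra (space M) (sets M)" ..
  show "positive (sets M) (\<lambda>A. emeasure M A + emeasure N A)"
    by (simp add: positive_def)
  show "countably_additive (sets M) (\<lambda>A. emeasure M A + emeasure N A)"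
  proof (rule countably_additiveI)
    fix B :: "nat \<Rightarrow> 'a set"
    assume B: "range B \<subseteq> sets M" "disjoint_family B"
    then have "(\<Sum>i. emeasure M (B i)) = emeasure M (\<Union>i. B i)"
      and "(\<Sum>i. emeasure N (B i)) = emeasure N (\<Union>i. B i)"
      using assms(1) by (auto intro!: suminf_emeasure)
    then show "(\<Sum>i. emeasure M (B i) + emeasure N (B i)) =
        emeasure M (\<Union>i. B i) + emeasure N (\<Union>i. B i)"
      by (simp add: suminf_add [symmetric])
  qed
qed fact

lemma sets_mu [simp, measurable_cong]: "sets (mu t) = sets borel"
  and space_mu [simp]: "space (mu t) = UNIV"
  by (simp_all add: mu_def space_scale_measure)

lemma nn_integral_mu:
  assumes [measurable]: "g \<in> borel_measurable borel"
  shows "(\<integral>\<^sup>+x. g x \<partial>mu t) = (1 / 2) * (\<integral>\<^sup>+x\<in>{t..t + 1}. g x \<partial>lborel)"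
  unfolding mu_def
  by (subst nn_integral_scale_measure)
     (auto simp: nn_integral_density mult.commute)

lemma emeasure_mu_UNIV: "emeasure (mu t) UNIV = 1 / 2"
  using nn_integral_mu [of "\<lambda>_. 1" t] by simp

lemma finite_measure_mu: "finite_measure (mu t)"
  by (rule finite_measureI) (simp add: emeasure_mu_UNIV ennreal_divide_eq_top_iff)

lemma sets_rho [simp, measurable_cong]: "sets (rho t) = sets borel"
  and space_rho [simp]: "space (rho t) = UNIV"
proof -
  show "sets (rho t) = sets borel"
    unfolding rho_def sets_add_measure
    by (simp add: borel_prod [symmetric] cong: sets_pair_measure_cong)
  then show "space (rho t) = UNIV"
    using sets_eq_imp_space_eq by fastforce
qed

lemma emeasure_rho:
  assumes A: "A \<in> sets borel"
  shows "emeasure (rho t) A =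
    (1 / 2) * emeasure lborel {s \<in> {t..t + 1}. (s, 0) \<in> A} +
    (1 / 2) * emeasure lborel {s \<in> {t..t + 1}. (0, s) \<in> A}"
proof -
  interpret m: finite_measure "mu t" by (rule finite_measure_mu)
  interpret d: prob_space dirac0 by (rule prob_space_return) simp
  have s1: "sets (mu t \<Otimes>\<^sub>M dirac0) = sets borel"
    and s2: "sets (dirac0 \<Otimes>\<^sub>M mu t) = sets borel"
    by (simp_all add: borel_prod [symmetric] cong: sets_pair_measure_cong)
  have [measurable]: "A \<in> sets ((borel :: real measure) \<Otimes>\<^sub>M (borel :: real measure))"
    using A unfolding borel_prod .
  have "emeasure (mu t \<Otimes>\<^sub>M dirac0) A = (\<integral>\<^sup>+s. indicator A (s, 0) \<partial>mu t)"
    using A s1 by (subst d.emeasure_pair_measure) (auto simp: nn_integral_return)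
  also have "\<dots> = (1 / 2) * (\<integral>\<^sup>+s\<in>{t..t + 1}. indicator A (s, 0) \<partial>lborel)"
    by (rule nn_integral_mu) measurable
  also have "(\<integral>\<^sup>+s\<in>{t..t + 1}. indicator A (s, 0) \<partial>lborel) =
      (\<integral>\<^sup>+s. indicator {s \<in> {t..t + 1}. (s, 0) \<in> A} s \<partial>lborel)"
    by (intro nn_integral_cong) (auto simp: indicator_def)
  also have "\<dots> = emeasure lborel {s \<in> {t..t + 1}. (s, 0) \<in> A}"
    by (rule nn_integral_indicator) measurable
  finally have 1: "emeasure (mu t \<Otimes>\<^sub>M dirac0) A =
      (1 / 2) * emeasure lborel {s \<in> {t..t + 1}. (s, 0) \<in> A}" .
  have "emeasure (dirac0 \<Otimes>\<^sub>M mu t) A =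
      (\<integral>\<^sup>+x. \<integral>\<^sup>+s. indicator A (x, s) \<partial>mu t \<partial>dirac0)"
    using A s2 by (subst m.emeasure_pair_measure) auto
  also have "\<dots> = (\<integral>\<^sup>+s. indicator A (0, s) \<partial>mu t)"
    by (rule nn_integral_return) (auto intro!: m.borel_measurable_nn_integral)
  also have "\<dots> = (1 / 2) * (\<integral>\<^sup>+s\<in>{t..t + 1}. indicator A (0, s) \<partial>lborel)"
    by (rule nn_integral_mu) measurable
  also have "(\<integral>\<^sup>+s\<in>{t..t + 1}. indicator A (0, s) \<partial>lborel) =
      (\<integral>\<^sup>+s. indicator {s \<in> {t..t + 1}. (0, s) \<in> A} s \<partial>lborel)"
    by (intro nn_integral_cong) (auto simp: indicator_def)
  also have "\<dots> = emeasure lborel {s \<in> {t..t + 1}. (0, s) \<in> A}"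
    by (rule nn_integral_indicator) measurable
  finally have 2: "emeasure (dirac0 \<Otimes>\<^sub>M mu t) A =
      (1 / 2) * emeasure lborel {s \<in> {t..t + 1}. (0, s) \<in> A}" .
  show ?thesis
    unfolding rho_def using A s1 s2 1 2 by (simp add: emeasure_add_measure)
qed

lemma prob_space_rho: "prob_space (rho t)"
proof (rule prob_spaceI)
  have *: "{s. t \<le> s \<and> s \<le> t + 1} = {t..t + 1}" by auto
  have "(1 / 2 + 1 / 2 :: ennreal) = 1"
    by (simp add: add_divide_distrib_ennreal [symmetric])
  then show "emeasure (rho t) (space (rho t)) = 1"
    by (simp add: emeasure_rho *)
qed

lemma rho_compact_support:
  "compact ({t..t + 1} \<times> {0} \<union> {0} \<times> {t..t + 1})"
  "emeasure (rho t) (- ({t..t + 1} \<times> {0} \<union> {0} \<times> {t..t + 1})) = 0"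
proof -
  show c: "compact ({t..t + 1} \<times> {0} \<union> {0} \<times> {t..t + 1})"
    by (intro compact_Un compact_Times) auto
  have e: "{s \<in> {t..t + 1}. (s, 0) \<in> - ({t..t + 1} \<times> {0} \<union> {0} \<times> {t..t + 1})} = {}"
    "{s \<in> {t..t + 1}. (0, s) \<in> - ({t..t + 1} \<times> {0} \<union> {0} \<times> {t..t + 1})} = {}"
    by auto
  have "- ({t..t + 1} \<times> {0} \<union> {0} \<times> {t..t + 1}) \<in> sets borel"
    using c by (intro borel_open open_Compl compact_imp_closed)
  then show "emeasure (rho t) (- ({t..t + 1} \<times> {0} \<union> {0} \<times> {t..t + 1})) = 0"
    by (simp only: emeasure_rho e emeasure_empty mult_zero_right add_0)
qed

end

theory Submission
  imports Defs
begin

text \<open>For \<open>t < 0 < t + 1\<close> the segments cross at an interior point. Put a small tent function centred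
  at the crossing on each segment. The two functions have disjoint supports, so they are orthogonal.
  Their coefficients with respect to an exponential are values of the Fourier transform of the tent
  function, which is nonnegative, so if the exponentials formed an orthogonal basis, Parseval's
  identity would write \<open>0\<close> as a sum of nonnegative terms. A sufficiently narrow tent makes any one
  chosen term positive.\<close>

section \<open>The space of square-integrable functions\<close>

lemma L2_fun_measurable [measurable_dest]: "f \<in> L2_fun M \<Longrightarrow> f \<in> borel_measurable M"
  and L2_fun_integrable: "f \<in> L2_fun M \<Longrightarrow> integrable M (\<lambda>x. (norm (f x))\<^sup>2)"
  by (simp_all add: L2_fun_def)

lemma L2_fun_add:
  assumes "f \<in> L2_fun M" "g \<in> L2_fun M"
  shows "(\<lambda>x. f x + g x) \<in> L2_fun M"
proof -
  note [measurable] = assms[THEN L2_fun_measurable]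
  have le: "(norm (f x + g x))\<^sup>2 \<le> 2 * (norm (f x))\<^sup>2 + 2 * (norm (g x))\<^sup>2" for x
  proof -
    have "(norm (f x + g x))\<^sup>2 \<le> (norm (f x) + norm (g x))\<^sup>2"
      by (intro power_mono norm_triangle_ineq) auto
    also have "\<dots> \<le> 2 * (norm (f x))\<^sup>2 + 2 * (norm (g x))\<^sup>2"
      using sum_squares_bound[of "norm (f x)" "norm (g x)"] by (simp add: power2_sum)
    finally show ?thesis .
  qed
  have "integrable M (\<lambda>x. 2 * (norm (f x))\<^sup>2 + 2 * (norm (g x))\<^sup>2)"
    using assms by (auto intro!: Bochner_Integration.integrable_add L2_fun_integrable)
  then have "integrable M (\<lambda>x. (norm (f x + g x))\<^sup>2)"
    by (rule Bochner_Integration.integrable_bound) (use le in auto)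
  then show ?thesis
    by (simp add: L2_fun_def)
qed

lemma L2_fun_scale: "f \<in> L2_fun M \<Longrightarrow> (\<lambda>x. c * f x) \<in> L2_fun M"
  by (auto simp: L2_fun_def norm_mult power_mult_distrib)

lemma L2_fun_diff: "f \<in> L2_fun M \<Longrightarrow> g \<in> L2_fun M \<Longrightarrow> (\<lambda>x. f x - g x) \<in> L2_fun M"
  using L2_fun_add[OF _ L2_fun_scale[of g M "-1"], of f] by simp

lemma L2_fun_sum:
  "(\<And>i. i \<in> I \<Longrightarrow> f i \<in> L2_fun M) \<Longrightarrow> (\<lambda>x. \<Sum>i\<in>I. f i x) \<in> L2_fun M"
proof (induction I rule: infinite_finite_induct)
  case (insert i I)
  then show ?case by (simp add: L2_fun_add)
qed (simp_all add: L2_fun_def)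

lemma (in finite_measure) bounded_imp_L2_fun:
  assumes [measurable]: "f \<in> borel_measurable M" and "\<And>x. norm (f x) \<le> B"
  shows "f \<in> L2_fun M"
proof -
  have "(norm (f x))\<^sup>2 \<le> B\<^sup>2" for x
    using assms(2)[of x] by (intro power_mono) auto
  then have "integrable M (\<lambda>x. (norm (f x))\<^sup>2)"
    by (intro integrable_const_bound[of _ "B\<^sup>2"]) auto
  then show ?thesis
    by (simp add: L2_fun_def)
qed

text \<open>Young's inequality, read off from a nonnegative square. The weight \<open>s\<close>
  stays free so that a factor of fixed norm can be scaled down first and the other factor made small
  afterwards.\<close>

lemma norm_mult_le_weighted:
  fixes a b :: complex
  assumes "s > 0"
  shows "norm (a * cnj b) \<le> (norm a)\<^sup>2 / (2 * s) + s / 2 * (norm b)\<^sup>2"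
proof -
  have "0 \<le> (norm a - s * norm b)\<^sup>2 / (2 * s)"
    using assms by simp
  also have "\<dots> = (norm a)\<^sup>2 / (2 * s) + s / 2 * (norm b)\<^sup>2 - norm (a * cnj b)"
    using assms by (simp add: norm_mult power2_eq_square field_simps)
  finally show ?thesis by simp
qed

lemma L2_integrable_mult:
  assumes "f \<in> L2_fun M" "g \<in> L2_fun M"
  shows "integrable M (\<lambda>x. f x * cnj (g x))"
proof -
  note [measurable] = assms[THEN L2_fun_measurable]
  have [measurable]: "(\<lambda>x. cnj (g x)) \<in> borel_measurable M"
    by (rule borel_measurable_continuous_on[where f = cnj]) (auto intro: continuous_intros)
  have "integrable M (\<lambda>x. (norm (f x))\<^sup>2 / (2 * 1) + 1 / 2 * (norm (g x))\<^sup>2)"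
    using assms by (auto intro!: Bochner_Integration.integrable_add L2_fun_integrable)
  then show ?thesis
  proof (rule Bochner_Integration.integrable_bound)
    show "AE x in M. norm (f x * cnj (g x))
        \<le> norm ((norm (f x))\<^sup>2 / (2 * 1) + 1 / 2 * (norm (g x))\<^sup>2)"
      using norm_mult_le_weighted[of 1] by (intro AE_I2) (simp add: abs_of_nonneg)
  qed measurable
qed

lemma L2_inner_commute: "L2_inner M g f = cnj (L2_inner M f g)"
  unfolding L2_inner_def by (subst Bochner_Integration.integral_cnj [symmetric]) (simp add: mult.commute)

lemma L2_inner_diff_left:
  "f \<in> L2_fun M \<Longrightarrow> g \<in> L2_fun M \<Longrightarrow> h \<in> L2_fun M \<Longrightarrow>
    L2_inner M (\<lambda>x. f x - g x) h = L2_inner M f h - L2_inner M g h"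
  unfolding L2_inner_def by (simp add: left_diff_distrib L2_integrable_mult)

lemma L2_inner_scale_left: "L2_inner M (\<lambda>x. c * f x) h = c * L2_inner M f h"
  unfolding L2_inner_def by (simp add: mult.assoc)

lemma L2_inner_sum_left:
  "(\<And>i. i \<in> I \<Longrightarrow> f i \<in> L2_fun M) \<Longrightarrow> h \<in> L2_fun M \<Longrightarrow>
    L2_inner M (\<lambda>x. \<Sum>i\<in>I. f i x) h = (\<Sum>i\<in>I. L2_inner M (f i) h)"
  unfolding L2_inner_def by (simp add: sum_distrib_right L2_integrable_mult)

lemma L2_norm_power2: "(L2_norm M f)\<^sup>2 = (\<integral>x. (norm (f x))\<^sup>2 \<partial>M)"
  by (simp add: L2_norm_def)

lemma L2_norm_nonneg: "0 \<le> L2_norm M f"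
  by (simp add: L2_norm_def)

text \<open>Pythagoras: the cross term of the pointwise expansion integrates to twice the real part
  of the inner product.\<close>

lemma L2_norm_add_orthogonal:
  assumes f: "f \<in> L2_fun M" and g: "g \<in> L2_fun M" and "L2_inner M f g = 0"
  shows "(L2_norm M (\<lambda>x. f x + g x))\<^sup>2 = (L2_norm M f)\<^sup>2 + (L2_norm M g)\<^sup>2"
proof -
  have eq: "(norm (f x + g x))\<^sup>2 = (norm (f x))\<^sup>2 + (norm (g x))\<^sup>2 + 2 * Re (f x * cnj (g x))" for x
    unfolding cmod_power2 by (simp add: power2_eq_square algebra_simps)
  have "(\<integral>x. Re (f x * cnj (g x)) \<partial>M) = Re (L2_inner M f g)"
    unfolding L2_inner_def by (rule integral_Re) (rule L2_integrable_mult[OF f g])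
  moreover have "integrable M (\<lambda>x. Re (f x * cnj (g x)))"
    by (rule integrable_Re) (rule L2_integrable_mult[OF f g])
  ultimately show ?thesis
    using f g assms(3)
    unfolding L2_norm_power2 eq by (simp add: L2_fun_integrable del: times_complex.sel)
qed

text \<open>Stands in for the Cauchy-Schwarz inequality, which is what optimising over
  \<open>s\<close> would give. It involves only squared norms and needs no case split on a vanishing
  norm.\<close>

lemma L2_inner_le_weighted:
  assumes f: "f \<in> L2_fun M" and g: "g \<in> L2_fun M" and "s > 0"
  shows "norm (L2_inner M f g) \<le> (L2_norm M f)\<^sup>2 / (2 * s) + s / 2 * (L2_norm M g)\<^sup>2"
proof -
  have "norm (L2_inner M f g) \<le> (\<integral>x. norm (f x * cnj (g x)) \<partial>M)"
    unfolding L2_inner_def by (rule integral_norm_bound)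
  also have "\<dots> \<le> (\<integral>x. (norm (f x))\<^sup>2 / (2 * s) + s / 2 * (norm (g x))\<^sup>2 \<partial>M)"
    using f g \<open>s > 0\<close>
    by (intro integral_mono norm_mult_le_weighted integrable_norm L2_integrable_mult
      Bochner_Integration.integrable_add integrable_mult_right integrable_divide L2_fun_integrable)
  also have "\<dots> = (L2_norm M f)\<^sup>2 / (2 * s) + s / 2 * (L2_norm M g)\<^sup>2"
    using f g by (simp add: L2_norm_power2 L2_fun_integrable)
  finally show ?thesis .
qed

text \<open>Best approximation by Fourier coefficients. The residual \<open>u\<close> is orthogonal
  to the span of the \<open>e l\<close>, and any other combination changes it by an element
  \<open>v\<close> of that span, so Pythagoras applies. Density provides unknown coefficients; this
  lemma replaces them by the Fourier coefficients.\<close>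

lemma L2_norm_residual_le:
  fixes e :: "'i \<Rightarrow> 'a \<Rightarrow> complex"
  assumes F: "finite F" and f: "f \<in> L2_fun M"
    and e: "\<And>l. l \<in> F \<Longrightarrow> e l \<in> L2_fun M"
    and orth: "\<And>l m. l \<in> F \<Longrightarrow> m \<in> F \<Longrightarrow> L2_inner M (e l) (e m) = (if l = m then 1 else 0)"
  shows "L2_norm M (\<lambda>x. f x - (\<Sum>l\<in>F. L2_inner M f (e l) * e l x))
    \<le> L2_norm M (\<lambda>x. f x - (\<Sum>l\<in>F. c l * e l x))"
proof -
  define u where "u = (\<lambda>x. f x - (\<Sum>l\<in>F. L2_inner M f (e l) * e l x))"
  define v where "v = (\<lambda>x. \<Sum>l\<in>F. (L2_inner M f (e l) - c l) * e l x)"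
  have u: "u \<in> L2_fun M"
    unfolding u_def using f e by (intro L2_fun_diff L2_fun_sum L2_fun_scale)
  have v: "v \<in> L2_fun M"
    unfolding v_def using e by (intro L2_fun_sum L2_fun_scale)
  have ue: "L2_inner M (e m) u = 0" if m: "m \<in> F" for m
  proof -
    have "L2_inner M u (e m) = L2_inner M f (e m)
        - (\<Sum>l\<in>F. L2_inner M f (e l) * L2_inner M (e l) (e m))"
      unfolding u_def using f e m
      by (simp add: L2_inner_diff_left L2_inner_sum_left L2_inner_scale_left L2_fun_sum L2_fun_scale)
    also have "(\<Sum>l\<in>F. L2_inner M f (e l) * L2_inner M (e l) (e m))
        = (\<Sum>l\<in>F. if l = m then L2_inner M f (e l) else 0)"
      using m by (intro sum.cong) (auto simp: orth)
    also have "\<dots> = L2_inner M f (e m)"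
      using F m by simp
    finally show ?thesis
      by (subst L2_inner_commute) simp
  qed
  have "L2_inner M v u = 0"
    unfolding v_def using e u
    by (simp add: L2_inner_sum_left L2_inner_scale_left L2_fun_scale ue)
  then have "L2_inner M u v = 0"
    by (subst L2_inner_commute) simp
  then have "(L2_norm M u)\<^sup>2 \<le> (L2_norm M (\<lambda>x. u x + v x))\<^sup>2"
    using L2_norm_add_orthogonal[OF u v] by simp
  then have "L2_norm M u \<le> L2_norm M (\<lambda>x. u x + v x)"
    by (rule power2_le_imp_le) (rule L2_norm_nonneg)
  also have "(\<lambda>x. u x + v x) = (\<lambda>x. f x - (\<Sum>l\<in>F. c l * e l x))"
    by (auto simp: u_def v_def left_diff_distrib sum_subtractf)
  finally show ?thesis
    by (simp add: u_def)
qed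

text \<open>By Parseval's identity the right-hand side is the sum of all the terms that are assumed
  nonnegative. Finite partial sums and density suffice, so no infinite sum appears.\<close>

lemma Parseval_term_le:
  fixes e :: "'i \<Rightarrow> 'a \<Rightarrow> complex"
  assumes f: "f \<in> L2_fun M" and g: "g \<in> L2_fun M"
    and e: "\<And>l. l \<in> \<Lambda> \<Longrightarrow> e l \<in> L2_fun M"
    and orth: "\<And>l m. l \<in> \<Lambda> \<Longrightarrow> m \<in> \<Lambda> \<Longrightarrow> L2_inner M (e l) (e m) = (if l = m then 1 else 0)"
    and dense: "\<And>\<epsilon>. \<epsilon> > 0 \<Longrightarrow> \<exists>F c. finite F \<and> F \<subseteq> \<Lambda> \<and>
      L2_norm M (\<lambda>x. f x - (\<Sum>l\<in>F. c l * e l x)) < \<epsilon>"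
    and nonneg: "\<And>l. l \<in> \<Lambda> \<Longrightarrow> 0 \<le> Re (L2_inner M f (e l) * cnj (L2_inner M g (e l)))"
    and k: "k \<in> \<Lambda>"
  shows "Re (L2_inner M f (e k) * cnj (L2_inner M g (e k))) \<le> Re (L2_inner M f g)"
proof (rule field_le_epsilon)
  fix \<delta> :: real assume "\<delta> > 0"
  \<comment> \<open>This weight makes the contribution of \<open>g\<close> to the error at most
    \<open>\<delta> / 2\<close>; the summand 1 keeps the denominator positive when \<open>g\<close>
    has norm 0.\<close>
  define s where "s = \<delta> / ((L2_norm M g)\<^sup>2 + 1)"
  have s: "s > 0"
    unfolding s_def using \<open>\<delta> > 0\<close> by (intro divide_pos_pos add_nonneg_pos) auto
  \<comment> \<open>The tolerance is chosen so that the squared residual divided by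
    \<open>2 * s\<close> is at most \<open>\<delta> / 2\<close>.\<close>
  obtain F c where F: "finite F" "F \<subseteq> \<Lambda>"
    and less: "L2_norm M (\<lambda>x. f x - (\<Sum>l\<in>F. c l * e l x)) < sqrt (s * \<delta>)"
    using dense[of "sqrt (s * \<delta>)"] s \<open>\<delta> > 0\<close> by auto
  \<comment> \<open>The index \<open>k\<close> is added so that its term occurs in the partial sum.
    The competing combination gives it coefficient 0 if it is new, so the approximation does not get
    worse.\<close>
  define F' where "F' = insert k F"
  have F': "finite F'" "F' \<subseteq> \<Lambda>" "k \<in> F'"
    using F k by (auto simp: F'_def)
  have e': "e l \<in> L2_fun M" if "l \<in> F'" for l
    using that F' e by blast
  have orth': "L2_inner M (e l) (e m) = (if l = m then 1 else 0)" if "l \<in> F'" "m \<in> F'" for l m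
    using that F' orth by blast
  define u where "u = (\<lambda>x. f x - (\<Sum>l\<in>F'. L2_inner M f (e l) * e l x))"
  have sum: "(\<lambda>x. \<Sum>l\<in>F'. L2_inner M f (e l) * e l x) \<in> L2_fun M"
    using e' by (intro L2_fun_sum L2_fun_scale)
  have u: "u \<in> L2_fun M"
    unfolding u_def using f sum by (rule L2_fun_diff)
  have "L2_norm M u \<le> L2_norm M (\<lambda>x. f x - (\<Sum>l\<in>F'. (if l \<in> F then c l else 0) * e l x))"
    unfolding u_def by (rule L2_norm_residual_le[OF F'(1) f e' orth'])
  also have "(\<lambda>x. f x - (\<Sum>l\<in>F'. (if l \<in> F then c l else 0) * e l x))
      = (\<lambda>x. f x - (\<Sum>l\<in>F. c l * e l x))"
    using F' F by (intro ext arg_cong2[of _ _ _ _ "(-)"] refl sum.mono_neutral_cong_right)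
      (auto simp: F'_def)
  finally have "(L2_norm M u)\<^sup>2 \<le> (sqrt (s * \<delta>))\<^sup>2"
    using less by (intro power_mono L2_norm_nonneg) simp
  then have "(L2_norm M u)\<^sup>2 / (2 * s) \<le> \<delta> / 2"
    using s \<open>\<delta> > 0\<close> by (simp add: field_simps)
  moreover have "s / 2 * (L2_norm M g)\<^sup>2 \<le> \<delta> / 2"
  proof -
    have "s * (L2_norm M g)\<^sup>2 \<le> s * ((L2_norm M g)\<^sup>2 + 1)"
      using s by simp
    also have "\<dots> = \<delta>"
      unfolding s_def by (simp add: add_nonneg_eq_0_iff)
    finally show ?thesis by simp
  qed
  ultimately have small: "norm (L2_inner M u g) \<le> \<delta>"
    using L2_inner_le_weighted[OF u g s] by linarith
  have "L2_inner M u g = L2_inner M f g - (\<Sum>l\<in>F'. L2_inner M f (e l) * cnj (L2_inner M g (e l)))"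
    unfolding u_def using f g sum e'
    by (simp add: L2_inner_diff_left L2_inner_sum_left L2_inner_scale_left L2_fun_scale
        L2_inner_commute[of M "e _" g])
  then have "Re (\<Sum>l\<in>F'. L2_inner M f (e l) * cnj (L2_inner M g (e l)))
      = Re (L2_inner M f g) - Re (L2_inner M u g)"
    by simp
  moreover have "- Re (L2_inner M u g) \<le> \<delta>"
    using small abs_Re_le_cmod[of "L2_inner M u g"] by linarith
  \<comment> \<open>Dropping the other terms of the partial sum only decreases it, as they are
    nonnegative.\<close>
  moreover have "Re (L2_inner M f (e k) * cnj (L2_inner M g (e k)))
      \<le> Re (\<Sum>l\<in>F'. L2_inner M f (e l) * cnj (L2_inner M g (e l)))"
    unfolding Re_sum using F' nonneg by (intro member_le_sum) auto
  ultimately show "Re (L2_inner M f (e k) * cnj (L2_inner M g (e k))) \<le> Re (L2_inner M f g) + \<delta>"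
    by linarith
qed

section \<open>Integration over the two segments\<close>

text \<open>The measure is realised as the image of half of Lebesgue measure on the interval
  from \<open>t\<close> to \<open>t + 2\<close>, whose two halves parametrise the two segments.\<close>

definition segments :: "real \<Rightarrow> real \<Rightarrow> real \<times> real" where
  "segments t s = (if s \<le> t + 1 then (s, 0) else (0, s - 1))"

lemma segments_measurable [measurable]: "segments t \<in> borel_measurable borel"
  unfolding segments_def by measurable

text \<open>A Borel set is tested through its traces \<open>B\<close> and \<open>C\<close> on the
  two segments; the second trace appears translated by 1, which Lebesgue measure does not
  see.\<close>

lemma rho_eq_distr:
  "rho t = distr (density lborel (\<lambda>s. ennreal (indicator {t..t + 2} s / 2))) borel (segments t)"
proof (rule measure_eqI)
  fix A assume "A \<in> sets (rho t)"
  then have A [measurable]: "A \<in> sets borel" by simp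
  define B where "B = {s \<in> {t..t + 1}. (s, 0) \<in> A}"
  define C where "C = {s \<in> {t..t + 1}. (0, s) \<in> A}"
  have [measurable]: "(\<lambda>s::real. (s, 0::real)) \<in> borel_measurable borel"
      "(\<lambda>s::real. (0::real, s)) \<in> borel_measurable borel"
    by (auto intro!: borel_measurable_continuous_onI continuous_intros)
  have [measurable]: "B \<in> sets borel" "C \<in> sets borel"
    unfolding B_def C_def by measurable
  have "emeasure (distr (density lborel (\<lambda>s. ennreal (indicator {t..t + 2} s / 2))) borel (segments t)) A
      = (\<integral>\<^sup>+s. ennreal (indicator {t..t + 2} s / 2) * indicator (segments t -` A) s \<partial>lborel)"
    using measurable_sets_borel[OF segments_measurable A]
    by (subst emeasure_distr, measurable) (simp add: emeasure_density)
  also have "\<dots> = (\<integral>\<^sup>+s. (1 / 2) * indicator B s + (1 / 2) * indicator C (s - 1) \<partial>lborel)"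
  proof (rule nn_integral_cong_AE)
    have half: "inverse 2 = (1 / 2 :: ennreal)"
      by (simp add: divide_ennreal_def)
    \<comment> \<open>At \<open>s = t + 1\<close> the closed parameter intervals overlap:
      \<open>segments\<close> chooses the horizontal end point, while \<open>C (s - 1)\<close> also
      counts the vertical one.\<close>
    have "AE s in lborel. s \<noteq> t + 1"
      by (rule AE_lborel_singleton)
    then show "AE s in lborel. ennreal (indicator {t..t + 2} s / 2) * indicator (segments t -` A) s
        = (1 / 2) * indicator B s + (1 / 2) * indicator C (s - 1)"
      by eventually_elim (auto simp: B_def C_def segments_def indicator_def half)
  qed
  also have "\<dots> = (1 / 2) * emeasure lborel B + (1 / 2) * (\<integral>\<^sup>+s. indicator C (s - 1) \<partial>lborel)"
    by (simp add: nn_integral_add nn_integral_cmult)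
  also have "(\<integral>\<^sup>+s. indicator C (s - 1) \<partial>lborel) = (\<integral>\<^sup>+s. indicator C s \<partial>lborel)"
    using nn_integral_real_affine[of "indicator C" 1 "-1"] by (simp add: algebra_simps)
  finally show "emeasure (rho t) A =
      emeasure (distr (density lborel (\<lambda>s. ennreal (indicator {t..t + 2} s / 2))) borel (segments t)) A"
    using A by (simp add: emeasure_rho B_def C_def)
qed simp

lemma integral_rho:
  fixes f :: "real \<times> real \<Rightarrow> complex"
  assumes [measurable]: "f \<in> borel_measurable borel"
  shows "(\<integral>x. f x \<partial>rho t) = (\<integral>s. (indicator {t..t + 2} s / 2) *\<^sub>R f (segments t s) \<partial>lborel)"
  unfolding rho_eq_distr by (simp add: integral_distr integral_density)

section \<open>The Fourier transform of a tent function\<close>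

text \<open>For \<open>\<epsilon> > 0\<close> this is the convolution of the indicator of the
  interval from \<open>-\<epsilon>/2\<close> to \<open>\<epsilon>/2\<close> with itself. Its Fourier
  transform is therefore the square of a real function.\<close>

definition tent :: "real \<Rightarrow> real \<Rightarrow> complex" where
  "tent \<epsilon> s = of_real (max 0 (\<epsilon> - \<bar>s\<bar>))"

text \<open>For nonzero \<open>k\<close> this equals the square of
  \<open>sin (k * \<epsilon> / 2) / (k / 2)\<close>, and the value at 0 is its limit. Here
  \<open>k\<close> is an angular frequency; the factor \<open>2 * pi\<close> enters when the
  exponentials are inserted.\<close>

definition tent_hat :: "real \<Rightarrow> real \<Rightarrow> real" where
  "tent_hat \<epsilon> k = (if k = 0 then \<epsilon>\<^sup>2 else 2 * (1 - cos (k * \<epsilon>)) / k\<^sup>2)"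

lemma tent_hat_nonneg: "0 \<le> tent_hat \<epsilon> k"
  by (simp add: tent_hat_def)

text \<open>The zeros of the transform have \<open>k * \<epsilon>\<close> equal to a nonzero
  multiple of \<open>2 * pi\<close>, outside the range allowed here.\<close>

lemma tent_hat_pos:
  assumes "\<epsilon> > 0" "\<bar>k\<bar> * \<epsilon> \<le> pi"
  shows "0 < tent_hat \<epsilon> k"
proof (cases "k = 0")
  case False
  have "cos (\<bar>k\<bar> * \<epsilon>) < cos 0"
    using assms False by (intro cos_monotone_0_pi) auto
  moreover have "cos (\<bar>k\<bar> * \<epsilon>) = cos (k * \<epsilon>)"
    by (cases "k \<ge> 0") auto
  ultimately show ?thesis
    using False by (simp add: tent_hat_def)
qed (use assms in \<open>simp add: tent_hat_def\<close>)

lemma tent_has_integral: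
  assumes "\<epsilon> > 0"
  shows "((\<lambda>s. tent \<epsilon> s * cis (- k * s)) has_integral of_real (tent_hat \<epsilon> k)) {-\<epsilon>..\<epsilon>}"
proof -
  \<comment> \<open>An antiderivative of \<open>(\<epsilon> + \<sigma> * s) * cis (- k * s)\<close>,
    found by integration by parts for nonzero \<open>k\<close>. The sign \<open>\<sigma> = 1\<close>
    belongs to the left flank of the tent and \<open>\<sigma> = -1\<close> to the right one.\<close>
  define P where "P = (\<lambda>\<sigma> s. if k = 0 then of_real (\<epsilon> * s + \<sigma> * s\<^sup>2 / 2)
    else of_real (\<epsilon> + \<sigma> * s) * cis (- k * s) * \<i> / of_real k
      + of_real (\<sigma> / k\<^sup>2) * cis (- k * s))"
  have cis: "((\<lambda>s. cis (- k * s)) has_vector_derivative (- \<i> * of_real k * cis (- k * s))) (at s within S)"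
    for s S
  proof -
    have "((\<lambda>s. cis (- k * s)) has_derivative (\<lambda>h. (- k * h) *\<^sub>R (\<i> * cis (- k * s)))) (at s within S)"
      by (auto intro!: derivative_eq_intros)
    then show ?thesis
      by (simp add: has_vector_derivative_def scaleR_conv_of_real algebra_simps)
  qed
  have P: "(P \<sigma> has_vector_derivative of_real (\<epsilon> + \<sigma> * s) * cis (- k * s)) (at s within S)" for \<sigma> s S
  proof (cases "k = 0")
    case True
    have "((\<lambda>s. \<epsilon> * s + \<sigma> * s\<^sup>2 / 2) has_real_derivative (\<epsilon> + \<sigma> * s)) (at s within S)"
      by (auto intro!: derivative_eq_intros)
    then have "((\<lambda>s. of_real (\<epsilon> * s + \<sigma> * s\<^sup>2 / 2) :: complex) has_vector_derivative of_real (\<epsilon> + \<sigma> * s)) (at s within S)"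
      by (intro has_vector_derivative_of_real) (simp add: has_real_derivative_iff_has_vector_derivative)
    then show ?thesis
      using True by (simp add: P_def)
  next
    case False
    have lin: "((\<lambda>s. of_real (\<epsilon> + \<sigma> * s) :: complex) has_vector_derivative of_real \<sigma>) (at s within S)"
      by (intro has_vector_derivative_of_real)
        (auto intro!: derivative_eq_intros simp: has_real_derivative_iff_has_vector_derivative [symmetric])
    have "((\<lambda>s. of_real (\<epsilon> + \<sigma> * s) * cis (- k * s) * (\<i> / of_real k)
        + of_real (\<sigma> / k\<^sup>2) * cis (- k * s)) has_vector_derivative
        (of_real (\<epsilon> + \<sigma> * s) * (- \<i> * of_real k * cis (- k * s)) + of_real \<sigma> * cis (- k * s)) * (\<i> / of_real k)
        + of_real (\<sigma> / k\<^sup>2) * (- \<i> * of_real k * cis (- k * s))) (at s within S)"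
      by (intro has_vector_derivative_add has_vector_derivative_mult_left has_vector_derivative_mult_right
          has_vector_derivative_mult lin cis)
    moreover have "(of_real (\<epsilon> + \<sigma> * s) * (- \<i> * of_real k * cis (- k * s)) + of_real \<sigma> * cis (- k * s)) * (\<i> / of_real k)
        + of_real (\<sigma> / k\<^sup>2) * (- \<i> * of_real k * cis (- k * s)) = of_real (\<epsilon> + \<sigma> * s) * cis (- k * s)"
      using False by (simp add: field_simps power2_eq_square)
    ultimately show ?thesis
      using False by (simp add: P_def)
  qed
  have right: "((\<lambda>s. tent \<epsilon> s * cis (- k * s)) has_integral (P (-1) \<epsilon> - P (-1) 0)) {0..\<epsilon>}"
  proof (rule has_integral_eq)
    show "((\<lambda>s. of_real (\<epsilon> + (-1) * s) * cis (- k * s)) has_integral (P (-1) \<epsilon> - P (-1) 0)) {0..\<epsilon>}"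
      using assms by (intro fundamental_theorem_of_calculus P) auto
  qed (auto simp: tent_def max_def)
  have left: "((\<lambda>s. tent \<epsilon> s * cis (- k * s)) has_integral (P 1 0 - P 1 (-\<epsilon>))) {-\<epsilon>..0}"
  proof (rule has_integral_eq)
    show "((\<lambda>s. of_real (\<epsilon> + 1 * s) * cis (- k * s)) has_integral (P 1 0 - P 1 (-\<epsilon>))) {-\<epsilon>..0}"
      using assms by (intro fundamental_theorem_of_calculus P) auto
  qed (auto simp: tent_def max_def)
  \<comment> \<open>For nonzero \<open>k\<close> the linear factor vanishes at both ends and its
    contributions at 0 cancel. What remains is 2 minus two conjugate exponentials, divided by
    \<open>k\<close> squared.\<close>
  have "(P 1 0 - P 1 (-\<epsilon>)) + (P (-1) \<epsilon> - P (-1) 0) = of_real (tent_hat \<epsilon> k)"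
    by (auto simp: P_def tent_hat_def complex_eq_iff field_simps power2_eq_square)
  then show ?thesis
    using has_integral_combine[OF _ _ left right] assms by simp
qed

text \<open>The tent vanishes outside its base, so enlarging the domain to \<open>S\<close> changes
  nothing. Later \<open>S\<close> is the interval carrying a segment.\<close>

lemma integral_tent:
  assumes "\<epsilon> > 0" and "{-\<epsilon>..\<epsilon>} \<subseteq> S"
  shows "(\<integral>s. indicator S s *\<^sub>R (tent \<epsilon> s * cis (- k * s)) \<partial>lborel) = of_real (tent_hat \<epsilon> k)"
proof -
  have cont: "continuous_on {-\<epsilon>..\<epsilon>} (\<lambda>s. tent \<epsilon> s * cis (- k * s))"
    unfolding tent_def by (intro continuous_intros)
  have int: "set_integrable lborel {-\<epsilon>..\<epsilon>} (\<lambda>s. tent \<epsilon> s * cis (- k * s))"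
    unfolding set_integrable_def by (rule borel_integrable_compact) (use cont in auto)
  have "(\<integral>s. indicator S s *\<^sub>R (tent \<epsilon> s * cis (- k * s)) \<partial>lborel)
      = (LINT s:{-\<epsilon>..\<epsilon>}|lborel. tent \<epsilon> s * cis (- k * s))"
    unfolding set_lebesgue_integral_def using assms(2)
    by (intro Bochner_Integration.integral_cong) (auto simp: indicator_def tent_def)
  also have "\<dots> = integral {-\<epsilon>..\<epsilon>} (\<lambda>s. tent \<epsilon> s * cis (- k * s))"
    by (rule set_borel_integral_eq_integral(2)[OF int])
  also have "\<dots> = of_real (tent_hat \<epsilon> k)"
    by (rule integral_unique) (rule tent_has_integral[OF assms(1)])
  finally show ?thesis .
qed

section \<open>Exponentials on the two segments\<close>

lemma exp_char_eq_cis: "exp_char l x = cis (2 * pi * (l \<bullet> x))"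
  by (simp add: exp_char_def cis_conv_exp mult_ac)

lemma cis_measurable [measurable]: "cis \<in> borel_measurable borel"
  by (intro borel_measurable_continuous_onI continuous_intros)

lemma exp_char_measurable [measurable]: "exp_char l \<in> borel_measurable borel"
  unfolding exp_char_def by (intro borel_measurable_continuous_onI continuous_intros)

lemma exp_char_L2_fun: "exp_char l \<in> L2_fun (rho t)"
proof -
  interpret prob_space "rho t" by (rule prob_space_rho)
  show ?thesis
    by (rule bounded_imp_L2_fun[where B = 1]) (simp_all add: exp_char_eq_cis)
qed

text \<open>Exponentials have modulus 1 and \<open>rho t\<close> has total mass 1, so an orthogonal
  family of exponentials is orthonormal, as \<open>Parseval_term_le\<close> requires.\<close>

lemma L2_inner_exp_char_self: "L2_inner (rho t) (exp_char l) (exp_char l) = 1"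
proof -
  interpret prob_space "rho t" by (rule prob_space_rho)
  show ?thesis
    using prob_space by (simp add: L2_inner_def exp_char_eq_cis cis_cnj cis_mult)
qed

text \<open>The crossing point of the segments is excluded from both supports, so that the products
  below vanish everywhere and not just almost everywhere.\<close>

definition horizontal_bump :: "real \<Rightarrow> real \<times> real \<Rightarrow> complex" where
  "horizontal_bump \<epsilon> x = (if snd x = 0 \<and> fst x \<noteq> 0 then tent \<epsilon> (fst x) else 0)"

definition vertical_bump :: "real \<Rightarrow> real \<times> real \<Rightarrow> complex" where
  "vertical_bump \<epsilon> x = (if fst x = 0 \<and> snd x \<noteq> 0 then tent \<epsilon> (snd x) else 0)"

lemma tent_measurable [measurable]: "tent \<epsilon> \<in> borel_measurable borel"
  unfolding tent_def by measurable

lemma bump_measurable [measurable]: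
  "horizontal_bump \<epsilon> \<in> borel_measurable borel" "vertical_bump \<epsilon> \<in> borel_measurable borel"
  unfolding horizontal_bump_def vertical_bump_def borel_prod [symmetric] by measurable

lemma norm_tent_le: "norm (tent \<epsilon> s) \<le> \<bar>\<epsilon>\<bar>"
  unfolding tent_def norm_of_real by linarith

lemma bump_L2_fun:
  "horizontal_bump \<epsilon> \<in> L2_fun (rho t)" "vertical_bump \<epsilon> \<in> L2_fun (rho t)"
proof -
  interpret prob_space "rho t" by (rule prob_space_rho)
  show "horizontal_bump \<epsilon> \<in> L2_fun (rho t)" "vertical_bump \<epsilon> \<in> L2_fun (rho t)"
    by (rule bounded_imp_L2_fun[where B = "\<bar>\<epsilon>\<bar>"];
      simp add: horizontal_bump_def vertical_bump_def norm_tent_le)+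
qed

lemma L2_inner_bumps: "L2_inner M (horizontal_bump \<epsilon>) (vertical_bump \<epsilon>) = 0"
proof -
  have "(\<lambda>x. horizontal_bump \<epsilon> x * cnj (vertical_bump \<epsilon> x)) = (\<lambda>_. 0)"
    by (simp add: horizontal_bump_def vertical_bump_def fun_eq_iff)
  then show ?thesis
    unfolding L2_inner_def by simp
qed

text \<open>Only the horizontal segment contributes, and on it the exponential depends on
  \<open>fst l\<close> alone. The factor 1/2 is the density of the measure along the
  segment.\<close>

lemma L2_inner_horizontal_bump:
  assumes "\<epsilon> > 0" "{-\<epsilon>..\<epsilon>} \<subseteq> {t..t + 1}"
  shows "L2_inner (rho t) (horizontal_bump \<epsilon>) (exp_char l) = of_real (tent_hat \<epsilon> (2 * pi * fst l) / 2)"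
proof -
  have [measurable]: "(\<lambda>x. cnj (exp_char l x)) \<in> borel_measurable borel"
    unfolding exp_char_def by (intro borel_measurable_continuous_onI continuous_intros)
  have "L2_inner (rho t) (horizontal_bump \<epsilon>) (exp_char l) = (\<integral>s. (indicator {t..t + 2} s / 2) *\<^sub>R
      (horizontal_bump \<epsilon> (segments t s) * cnj (exp_char l (segments t s))) \<partial>lborel)"
    unfolding L2_inner_def by (rule integral_rho) measurable
  also have "\<dots> = (\<integral>s. (1 / 2) *\<^sub>R
      (indicator {t..t + 1} s *\<^sub>R (tent \<epsilon> s * cis (- (2 * pi * fst l) * s))) \<partial>lborel)"
  proof (rule Bochner_Integration.integral_cong_AE)
    \<comment> \<open>The parameter 0 is mapped to the crossing point, where the bump was set to
      0.\<close>
    have "AE s in lborel. s \<noteq> 0"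
      by (rule AE_lborel_singleton)
    then show "AE s in lborel. (indicator {t..t + 2} s / 2) *\<^sub>R
        (horizontal_bump \<epsilon> (segments t s) * cnj (exp_char l (segments t s))) =
        (1 / 2) *\<^sub>R (indicator {t..t + 1} s *\<^sub>R (tent \<epsilon> s * cis (- (2 * pi * fst l) * s)))"
      by eventually_elim
        (auto simp: segments_def horizontal_bump_def exp_char_eq_cis cis_cnj indicator_def mult_ac inner_prod_def)
  qed measurable
  also have "\<dots> = of_real (tent_hat \<epsilon> (2 * pi * fst l) / 2)"
    using integral_tent[OF assms, of "2 * pi * fst l"] by (simp add: scaleR_conv_of_real)
  finally show ?thesis .
qed

text \<open>The vertical segment is parametrised by \<open>s - 1\<close>, so a translation by 1
  reduces this to the same one-dimensional integral, now with \<open>snd l\<close>.\<close>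

lemma L2_inner_vertical_bump:
  assumes "\<epsilon> > 0" "{-\<epsilon>..\<epsilon>} \<subseteq> {t..t + 1}"
  shows "L2_inner (rho t) (vertical_bump \<epsilon>) (exp_char l) = of_real (tent_hat \<epsilon> (2 * pi * snd l) / 2)"
proof -
  have [measurable]: "(\<lambda>x. cnj (exp_char l x)) \<in> borel_measurable borel"
    unfolding exp_char_def by (intro borel_measurable_continuous_onI continuous_intros)
  define h where "h = (\<lambda>s. (1 / 2) *\<^sub>R
      (indicator {t..t + 1} s *\<^sub>R (tent \<epsilon> s * cis (- (2 * pi * snd l) * s))))"
  have "L2_inner (rho t) (vertical_bump \<epsilon>) (exp_char l) = (\<integral>s. (indicator {t..t + 2} s / 2) *\<^sub>R
      (vertical_bump \<epsilon> (segments t s) * cnj (exp_char l (segments t s))) \<partial>lborel)"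
    unfolding L2_inner_def by (rule integral_rho) measurable
  also have "\<dots> = (\<integral>s. h (- 1 + 1 * s) \<partial>lborel)"
  proof (rule Bochner_Integration.integral_cong_AE)
    \<comment> \<open>Here the crossing point has parameter 1. At \<open>s = t + 1\<close> the map
      \<open>segments\<close> still gives a horizontal point, although \<open>s - 1\<close> already
      lies in the vertical interval.\<close>
    have "AE s in lborel. s \<noteq> 1" "AE s in lborel. s \<noteq> t + 1"
      by (rule AE_lborel_singleton)+
    then show "AE s in lborel. (indicator {t..t + 2} s / 2) *\<^sub>R
        (vertical_bump \<epsilon> (segments t s) * cnj (exp_char l (segments t s))) = h (- 1 + 1 * s)"
      by eventually_elim
        (auto simp: h_def segments_def vertical_bump_def exp_char_eq_cis cis_cnj indicator_def mult_ac
          inner_prod_def algebra_simps)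
  qed (unfold h_def, measurable)
  also have "\<dots> = (\<integral>s. h s \<partial>lborel)"
    using lborel_integral_real_affine[of 1 h "-1"] by simp
  also have "\<dots> = of_real (tent_hat \<epsilon> (2 * pi * snd l) / 2)"
    unfolding h_def using integral_tent[OF assms, of "2 * pi * snd l"]
    by (simp add: scaleR_conv_of_real)
  finally show ?thesis .
qed

text \<open>The bounds on \<open>t\<close> say that 0 is interior to the interval from
  \<open>t\<close> to \<open>t + 1\<close>, which leaves room for a symmetric tent on each
  segment.\<close>

theorem not_spectral_rho:
  assumes "- 1 < t" and "t < 0"
  shows "\<not> spectral (rho t)"
proof
  assume "spectral (rho t)"
  then obtain \<Lambda> where \<Lambda>: "is_spectrum (rho t) \<Lambda>"
    by (auto simp: spectral_def)
  have orth: "L2_inner (rho t) (exp_char l) (exp_char l') = 0"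
    if "l \<in> \<Lambda>" "l' \<in> \<Lambda>" "l \<noteq> l'" for l l'
    using \<Lambda> that by (simp add: is_spectrum_def)
  have dense: "\<exists>F c. finite F \<and> F \<subseteq> \<Lambda> \<and>
      L2_norm (rho t) (\<lambda>x. f x - (\<Sum>l\<in>F. c l * exp_char l x)) < \<epsilon>"
    if "f \<in> L2_fun (rho t)" "\<epsilon> > 0" for f \<epsilon>
    using \<Lambda> that by (simp add: is_spectrum_def)
  interpret prob_space "rho t" by (rule prob_space_rho)
  \<comment> \<open>A spectrum is nonempty: the empty sum is at distance exactly 1 from the constant
    1, so it fails the tolerance 1.\<close>
  obtain k where k: "k \<in> \<Lambda>"
  proof -
    have one: "(\<lambda>_. 1) \<in> L2_fun (rho t)"
      by (rule bounded_imp_L2_fun[where B = 1]) auto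
    have "L2_norm (rho t) (\<lambda>_. 1) = 1"
      using prob_space by (simp add: L2_norm_def)
    then have "\<Lambda> \<noteq> {}"
      using dense[OF one, of 1] by auto
    then show ?thesis using that by blast
  qed
  \<comment> \<open>The first two bounds keep the base of the tent inside the interval. The third
    puts both angular frequencies of \<open>k\<close> in the range of \<open>tent_hat_pos\<close>;
    the summand 1 avoids division by 0 when \<open>k\<close> is the origin.\<close>
  define \<epsilon> where "\<epsilon> = min (min (- t) (t + 1)) (1 / (2 * (\<bar>fst k\<bar> + \<bar>snd k\<bar> + 1)))"
  have "\<epsilon> \<le> - t" "\<epsilon> \<le> t + 1" "\<epsilon> > 0"
    using assms by (auto simp: \<epsilon>_def)
  then have eps: "\<epsilon> > 0" "{-\<epsilon>..\<epsilon>} \<subseteq> {t..t + 1}"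
    by auto
  have bound: "\<bar>2 * pi * a\<bar> * \<epsilon> \<le> pi" if "\<bar>a\<bar> \<le> \<bar>fst k\<bar> + \<bar>snd k\<bar>" for a
  proof -
    have "2 * \<bar>a\<bar> * \<epsilon> \<le> (2 * (\<bar>fst k\<bar> + \<bar>snd k\<bar> + 1)) * (1 / (2 * (\<bar>fst k\<bar> + \<bar>snd k\<bar> + 1)))"
      using that eps(1) by (intro mult_mono) (auto simp: \<epsilon>_def)
    also have "\<dots> = 1"
      by simp
    finally have "pi * (2 * \<bar>a\<bar> * \<epsilon>) \<le> pi * 1"
      by (intro mult_left_mono) auto
    then show ?thesis
      by (simp add: abs_mult mult_ac)
  qed
  let ?f = "horizontal_bump \<epsilon>" and ?g = "vertical_bump \<epsilon>"
  have coeff: "Re (L2_inner (rho t) ?f (exp_char l) * cnj (L2_inner (rho t) ?g (exp_char l)))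
      = tent_hat \<epsilon> (2 * pi * fst l) * tent_hat \<epsilon> (2 * pi * snd l) / 4" for l
    by (simp add: L2_inner_horizontal_bump[OF eps] L2_inner_vertical_bump[OF eps])
  have "Re (L2_inner (rho t) ?f (exp_char k) * cnj (L2_inner (rho t) ?g (exp_char k)))
      \<le> Re (L2_inner (rho t) ?f ?g)"
  proof (rule Parseval_term_le[where e = exp_char and \<Lambda> = \<Lambda>])
    show "0 \<le> Re (L2_inner (rho t) ?f (exp_char l) * cnj (L2_inner (rho t) ?g (exp_char l)))" for l
      unfolding coeff by (simp add: tent_hat_nonneg)
    show "L2_inner (rho t) (exp_char l) (exp_char m) = (if l = m then 1 else 0)"
      if "l \<in> \<Lambda>" "m \<in> \<Lambda>" for l m
      using that by (simp add: orth L2_inner_exp_char_self)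
    show "\<exists>F c. finite F \<and> F \<subseteq> \<Lambda> \<and>
        L2_norm (rho t) (\<lambda>x. ?f x - (\<Sum>l\<in>F. c l * exp_char l x)) < \<delta>" if "\<delta> > 0" for \<delta>
      using bump_L2_fun(1) that by (rule dense)
  qed (simp_all add: k bump_L2_fun exp_char_L2_fun)
  \<comment> \<open>This is the term of \<open>k\<close> up to \<open>coeff\<close>, and it cannot
    be at most the inner product of the bumps, which is 0.\<close>
  moreover have "0 < tent_hat \<epsilon> (2 * pi * fst k) * tent_hat \<epsilon> (2 * pi * snd k) / 4"
    using eps(1) by (auto intro!: mult_pos_pos tent_hat_pos bound)
  ultimately show False
    unfolding coeff by (simp add: L2_inner_bumps)
qed

theorem theorem1p1:
  fixes t :: real
  assumes "- (1 / 2) < t" and "t < 0"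
  shows "\<not> spectral (rho t)"
  using assms by (intro not_spectral_rho) auto

end
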